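(* There exist absolute constants $\kappa>0$ and $n_0$ such that for all integers $n\ge n_0$: (1) For every $p=p(n)\in[0,1]$ with $p\le 1/n$, if a graphical game is sampled from $\mathcal{D}_{(n,p)}$, the probability that a pure Nash equilibrium exists is at most $\exp(-\kappa n^2p)$. (2) If $p=p(n)=g(n)/n$ with $1<g(n)<\log_e(n)/2$, and a graphical game is sampled from $\mathcal{D}_{(n,p)}$, the probability that a pure Nash equilibrium exists is at most $\exp\!\big(-\kappa\, e^{\log_e(n)-2g(n)}\big)$. In particular, if $p=p(n)$ satisfies $n^2p(n)\to+\infty$ and $p(n)<(0.5-\varepsilon'(n))\frac{\log_e(n)}{n}$, where $\varepsilon'(n)\log_e(n)\to+\infty$ as $n\to+\infty$, then the probability that a game sampled from $\mathcal{D}_{(n,p(n))}$ has a pure Nash equilibrium tends to $0$ as $n\to+\infty$.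
   Context: Graphs are finite, simple and undirected. For a graph $G=(V,E)$ and $v\in V$, $\mathcal{N}(v)=\{v'\in V: (v,v')\in E\}$. Random best-response model $\mathcal{D}_G$: the players are the vertices of $G$, each player $v$ has strategy set $S_v=\{0,1\}$. A (binary) game on $G$ is specified by best-response tables $\mathrm{BR}_v:\{0,1\}\times\{0,1\}^{\mathcal{N}(v)}\to\{0,1\}$, $v\in V$. Under $\mathcal{D}_G$, the values $\mathrm{BR}_v(0,\sigma_{\mathcal{N}(v)})$, over all $v\in V$ and all $\sigma_{\mathcal{N}(v)}\in\{0,1\}^{\mathcal{N}(v)}$, are mutually independent and uniform in $\{0,1\}$, and $\mathrm{BR}_v(1,\sigma_{\mathcal{N}(v)})=1-\mathrm{BR}_v(0,\sigma_{\mathcal{N}(v)})$. (This is the law, up to probability-zero events, of the best-response tables of a graphical game on $G$ all of whose payoff entries are i.i.d. from an atomless distribution on $\mathbb{R}$, where $\mathrm{BR}_v(\sigma_v,\sigma_{\mathcal{N}(v)})=1$ iff $\sigma_v$ maximizes the payoff of $v$ given $\sigma_{\mathcal{N}(v)}$.) A pure Nash equilibrium (PNE) is a profile $\sigma\in\{0,1\}^V$ with $\mathrm{BR}_v(\sigma_v,\sigma_{\mathcal{N}(v)})=1$ for all $v\in V$. The measure $\mathcal{D}_{(n,p)}$: first draw $G$ from the Erdős–Rényi model $G(n,p)$ ($n$ vertices, each edge present independently with probability $p$), then draw a game from $\mathcal{D}_G$. *)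

theory Defs
  imports "HOL-Probability.Probability" "HOL-Library.FuncSet"
begin

text \<open>A graph is a pair of a vertex set and a set of edges, an edge being a two-element set of
  vertices. The strategies \<open>0\<close> and \<open>1\<close> are represented by \<open>False\<close> and \<open>True\<close>.\<close>

type_synonym 'v graph = "'v set \<times> 'v set set"

definition simple_graph :: "'v graph \<Rightarrow> bool" where
  "simple_graph G \<longleftrightarrow> finite (fst G) \<and> (\<forall>e \<in> snd G. e \<subseteq> fst G \<and> card e = 2)"

definition nbhd :: "'v graph \<Rightarrow> 'v \<Rightarrow> 'v set" where
  "nbhd G v = {w \<in> fst G. {v, w} \<in> snd G}"

text \<open>\<open>BR v s \<tau>\<close> is the best-response table of player \<open>v\<close> at the strategy \<open>s\<close> of \<open>v\<close> and the
  neighbours' strategies \<open>\<tau> \<in> nbhd G v \<rightarrow>\<^sub>E UNIV\<close>; it is only ever consulted at such \<open>\<tau>\<close>.\<close>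

type_synonym 'v game = "'v \<Rightarrow> bool \<Rightarrow> ('v \<Rightarrow> bool) \<Rightarrow> bool"

definition is_PNE :: "'v graph \<Rightarrow> 'v game \<Rightarrow> ('v \<Rightarrow> bool) \<Rightarrow> bool" where
  "is_PNE G BR \<sigma> \<longleftrightarrow>
     \<sigma> \<in> (fst G \<rightarrow>\<^sub>E UNIV) \<and> (\<forall>v \<in> fst G. BR v (\<sigma> v) (restrict \<sigma> (nbhd G v)))"

definition has_PNE :: "'v graph \<Rightarrow> 'v game \<Rightarrow> bool" where
  "has_PNE G BR \<longleftrightarrow> (\<exists>\<sigma>. is_PNE G BR \<sigma>)"

text \<open>The sampled bits \<open>b (v, \<tau>)\<close> are the values \<open>BR v 0 \<tau>\<close>.\<close>

definition game_index :: "'v graph \<Rightarrow> ('v \<times> ('v \<Rightarrow> bool)) set" where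
  "game_index G = (SIGMA v : fst G. nbhd G v \<rightarrow>\<^sub>E UNIV)"

definition BR_of_bits :: "('v \<times> ('v \<Rightarrow> bool) \<Rightarrow> bool) \<Rightarrow> 'v game" where
  "BR_of_bits b = (\<lambda>v s \<tau>. if s then \<not> b (v, \<tau>) else b (v, \<tau>))"

definition game_pmf :: "'v graph \<Rightarrow> 'v game pmf" where
  "game_pmf G =
     map_pmf BR_of_bits (Pi_pmf (game_index G) False (\<lambda>_. pmf_of_set (UNIV :: bool set)))"

definition potential_edges :: "nat \<Rightarrow> nat set set" where
  "potential_edges n = {e. e \<subseteq> {..<n} \<and> card e = 2}"

definition erdos_renyi :: "nat \<Rightarrow> real \<Rightarrow> nat graph pmf" where
  "erdos_renyi n p =
     map_pmf (\<lambda>b. ({..<n}, {e \<in> potential_edges n. b e}))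
       (Pi_pmf (potential_edges n) False (\<lambda>_. bernoulli_pmf p))"

definition random_game :: "nat \<Rightarrow> real \<Rightarrow> (nat graph \<times> nat game) pmf" where
  "random_game n p =
     bind_pmf (erdos_renyi n p) (\<lambda>G. map_pmf (\<lambda>BR. (G, BR)) (game_pmf G))"

definition prob_PNE :: "nat \<Rightarrow> real \<Rightarrow> real" where
  "prob_PNE n p = measure_pmf.prob (random_game n p) {(G, BR). has_PNE G BR}"

text \<open>\<^const>\<open>Pi_pmf\<close> is the product distribution only over a finite index set.\<close>

lemma finite_potential_edges: "finite (potential_edges n)"
  by (rule finite_subset[of _ "Pow {..<n}"]) (auto simp: potential_edges_def)

lemma finite_game_index: "simple_graph G \<Longrightarrow> finite (game_index G)"
  by (auto simp: game_index_def simple_graph_def nbhd_def intro!: finite_SigmaI finite_PiE)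

lemma simple_graph_erdos_renyi: "G \<in> set_pmf (erdos_renyi n p) \<Longrightarrow> simple_graph G"
  by (auto simp: erdos_renyi_def simple_graph_def potential_edges_def)

end

theory Submission
  imports Defs "HOL-Real_Asymp.Real_Asymp"
begin

text \<open>The two players of an isolated edge play a game of their own, which is a matching pennies game,
  and so has no equilibrium, with probability \<open>1/8\<close>. Games on different isolated edges are
  independent, so a graph with \<open>X\<close> isolated edges has an equilibrium with probability at most
  \<open>(7/8)\<^sup>X\<close>, and it remains to bound the mean of \<open>(7/8)\<^sup>X\<close> over \<open>G(n,p)\<close>. Explore the graph one untouched
  vertex at a time: reveal its neighbours and, if there is just one and it is untouched, the
  neighbours of that one as well. The mean of \<open>(7/8)\<^sup>X\<close> over the part not yet revealed, with \<open>u\<close>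
  untouched vertices left, is at most \<open>exp (- \<alpha> (u - n/2))\<close> by induction on \<open>u\<close>: the potential
  absorbs the vertices lost in a step because \<open>\<alpha>\<close> is small compared with the probability that the
  step finds an isolated edge.\<close>

section \<open>Random subsets\<close>

text \<open>Subsets in place of Boolean functions let one calculus serve three purposes: the edges
  of \<open>G(n,p)\<close>, the neighbours of an explored vertex, and, with parameter
  \<open>1/2\<close>, the fair bits of a game.\<close>

definition random_subset :: "real \<Rightarrow> 'a set \<Rightarrow> 'a set pmf" where
  "random_subset p A = map_pmf (\<lambda>b. {x \<in> A. b x}) (Pi_pmf A False (\<lambda>_. bernoulli_pmf p))"

definition subset_mean :: "real \<Rightarrow> 'a set \<Rightarrow> ('a set \<Rightarrow> real) \<Rightarrow> real" where
  "subset_mean p A f = measure_pmf.expectation (random_subset p A) f"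

lemma set_random_subset: "set_pmf (random_subset p A) \<subseteq> Pow A"
  by (auto simp: random_subset_def)

lemma finite_set_random_subset: "finite A \<Longrightarrow> finite (set_pmf (random_subset p A))"
  by (rule finite_subset[OF set_random_subset]) simp

lemma subset_mean_mono:
  assumes "finite A" "\<And>S. S \<subseteq> A \<Longrightarrow> f S \<le> g S"
  shows "subset_mean p A f \<le> subset_mean p A g"
  unfolding subset_mean_def
  using assms set_random_subset[of p A]
  by (intro integral_mono_AE integrable_measure_pmf_finite finite_set_random_subset)
     (auto simp: AE_measure_pmf_iff)

lemma subset_mean_cong:
  assumes "finite A" "\<And>S. S \<subseteq> A \<Longrightarrow> f S = g S"
  shows "subset_mean p A f = subset_mean p A g"
  by (intro antisym subset_mean_mono) (use assms in auto)

lemma subset_mean_const [simp]: "subset_mean p A (\<lambda>_. c) = c"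
  by (simp add: subset_mean_def)

lemma subset_mean_cmult: "subset_mean p A (\<lambda>S. c * f S) = c * subset_mean p A f"
  by (simp add: subset_mean_def)

lemma subset_mean_diff:
  "finite A \<Longrightarrow> subset_mean p A (\<lambda>S. f S - g S) = subset_mean p A f - subset_mean p A g"
  unfolding subset_mean_def
  by (intro Bochner_Integration.integral_diff integrable_measure_pmf_finite finite_set_random_subset)

lemma subset_mean_sum:
  "finite A \<Longrightarrow> subset_mean p A (\<lambda>S. \<Sum>i\<in>I. f i S) = (\<Sum>i\<in>I. subset_mean p A (f i))"
  unfolding subset_mean_def
  by (intro Bochner_Integration.integral_sum integrable_measure_pmf_finite finite_set_random_subset)

lemma subset_mean_empty [simp]: "subset_mean p {} f = f {}"
  by (simp add: subset_mean_def random_subset_def)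

lemma random_subset_insert:
  assumes "finite A" "a \<notin> A"
  shows "random_subset p (insert a A) =
    bind_pmf (bernoulli_pmf p) (\<lambda>x. map_pmf (\<lambda>S. if x then insert a S else S) (random_subset p A))"
  unfolding random_subset_def
  using assms
  by (auto simp: Pi_pmf_insert pair_pmf_def map_bind_pmf bind_map_pmf map_pmf_comp
      map_pmf_def[symmetric] split: if_splits intro!: bind_pmf_cong map_pmf_cong)

text \<open>Conditioning on whether \<open>a\<close> is chosen. This recursion drives the inductions
  over the ground set below.\<close>

lemma subset_mean_insert:
  assumes "finite A" "a \<notin> A" "0 \<le> p" "p \<le> 1"
  shows "subset_mean p (insert a A) f =
    p * subset_mean p A (\<lambda>S. f (insert a S)) + (1 - p) * subset_mean p A f"
proof -
  have "subset_mean p (insert a A) f =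
     measure_pmf.expectation (bernoulli_pmf p)
       (\<lambda>x. subset_mean p A (\<lambda>S. f (if x then insert a S else S)))"
    unfolding subset_mean_def random_subset_insert[OF assms(1,2)]
    by (subst pmf_expectation_bind[where A = UNIV])
       (auto simp: assms(1) finite_set_random_subset integral_measure_pmf[where A = UNIV])
  also have "\<dots> = p * subset_mean p A (\<lambda>S. f (insert a S)) + (1 - p) * subset_mean p A f"
    using assms by (simp add: integral_measure_pmf[where A = UNIV] UNIV_bool algebra_simps)
  finally show ?thesis .
qed

text \<open>Independence of the choices on disjoint ground sets, in the form of an iterated mean, so
  that one part can be revealed before the other.\<close>

lemma subset_mean_union:
  assumes "finite A" "finite B" "A \<inter> B = {}" "0 \<le> p" "p \<le> 1"
  shows "subset_mean p (A \<union> B) f = subset_mean p A (\<lambda>S. subset_mean p B (\<lambda>S'. f (S \<union> S')))"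
  using assms(1,3)
proof (induction A arbitrary: f rule: finite_induct)
  case (insert a A)
  then show ?case
    using assms by (simp add: subset_mean_insert)
qed simp

text \<open>Marginals: what happens outside \<open>B\<close> averages out.\<close>

lemma subset_mean_inter:
  assumes "finite A" "B \<subseteq> A" "0 \<le> p" "p \<le> 1"
  shows "subset_mean p A (\<lambda>S. f (S \<inter> B)) = subset_mean p B f"
proof -
  have fB: "finite B" using assms finite_subset by blast
  have "subset_mean p A (\<lambda>S. f (S \<inter> B)) = subset_mean p (B \<union> (A - B)) (\<lambda>S. f (S \<inter> B))"
    using assms by (simp add: Un_absorb1)
  also have "\<dots> = subset_mean p B (\<lambda>S. subset_mean p (A - B) (\<lambda>S'. f ((S \<union> S') \<inter> B)))"
    using assms fB by (intro subset_mean_union) auto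
  also have "\<dots> = subset_mean p B (\<lambda>S. subset_mean p (A - B) (\<lambda>S'. f S))"
    using assms fB by (intro subset_mean_cong arg_cong[where f = f]) auto
  finally show ?thesis by simp
qed

lemma subset_mean_image:
  assumes "finite A" "inj_on h A" "0 \<le> p" "p \<le> 1"
  shows "subset_mean p (h ` A) f = subset_mean p A (\<lambda>S. f (h ` S))"
  using assms(1,2)
proof (induction A arbitrary: f rule: finite_induct)
  case (insert a A)
  then show ?case
    using assms(3,4) by (simp add: subset_mean_insert)
qed simp

text \<open>The generating function of a binomial variable, here for the number of vertices lost in
  an exploration step.\<close>

lemma subset_mean_power_card:
  assumes "finite A" "0 \<le> p" "p \<le> 1"
  shows "subset_mean p A (\<lambda>S. x ^ card S) = (1 + p * (x - 1)) ^ card A"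
  using assms(1)
proof (induction A rule: finite_induct)
  case (insert a A)
  have "subset_mean p A (\<lambda>S. x ^ card (insert a S)) = subset_mean p A (\<lambda>S. x * x ^ card S)"
    using insert by (intro subset_mean_cong) (auto simp: finite_subset card_insert_if)
  then show ?case
    using assms insert by (simp add: subset_mean_insert subset_mean_cmult algebra_simps)
qed simp

lemma subset_mean_indicator:
  assumes "finite A" "B \<subseteq> A" "0 \<le> p" "p \<le> 1"
  shows "subset_mean p A (\<lambda>S. of_bool (S = B)) = p ^ card B * (1 - p) ^ card (A - B)"
  using assms(1,2)
proof (induction A arbitrary: B rule: finite_induct)
  case (insert a A)
  show ?case
  proof (cases "a \<in> B")
    case True
    then obtain C where C: "B = insert a C" "a \<notin> C"
      by (meson mk_disjoint_insert)
    have CA: "C \<subseteq> A" using C insert by auto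
    have fC: "finite C" using CA insert(1) by (rule finite_subset)
    have "subset_mean p A (\<lambda>S. of_bool (insert a S = B)) = subset_mean p A (\<lambda>S. of_bool (S = C))"
    proof (intro subset_mean_cong)
      fix S assume "S \<subseteq> A"
      then have "a \<notin> S" using insert by auto
      then show "of_bool (insert a S = B) = (of_bool (S = C) :: real)"
        using C by (simp add: insert_ident)
    qed (use insert in auto)
    moreover have "subset_mean p A (\<lambda>S. of_bool (S = B)) = subset_mean p A (\<lambda>S. 0)"
      using C insert by (intro subset_mean_cong) auto
    moreover have "insert a A - B = A - C" using C insert by auto
    ultimately show ?thesis
      using C CA fC insert assms by (simp add: subset_mean_insert)
  next
    case False
    then have BA: "B \<subseteq> A" using insert by auto
    have "subset_mean p A (\<lambda>S. of_bool (insert a S = B)) = subset_mean p A (\<lambda>S. 0)"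
      using False by (intro subset_mean_cong) (use insert in auto)
    moreover have "insert a A - B = insert a (A - B)" "a \<notin> A - B" using False insert by auto
    ultimately show ?thesis
      using BA insert assms by (simp add: subset_mean_insert)
  qed
qed simp


text \<open>Independence of many disjoint blocks. The block \<open>D e\<close> is split off and the
  induction continues on \<open>I - D e\<close>, hence the arbitrary \<open>I\<close>.\<close>

lemma subset_mean_prod:
  fixes f :: "'e \<Rightarrow> 'a set \<Rightarrow> real"
  assumes "finite F" "finite I" "\<And>e. e \<in> F \<Longrightarrow> D e \<subseteq> I" "disjoint_family_on D F" and p: "0 \<le> p" "p \<le> 1"
  shows "subset_mean p I (\<lambda>S. \<Prod>e\<in>F. f e (S \<inter> D e)) = (\<Prod>e\<in>F. subset_mean p (D e) (f e))"
  using assms(1-4)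
proof (induction F arbitrary: I rule: finite_induct)
  case (insert e F)
  have De: "D e \<subseteq> I" and fD: "finite (D e)" using insert.prems by (auto intro: finite_subset)
  have dis: "D e \<inter> D e' = {}" if "e' \<in> F" for e'
    using disjoint_family_onD[OF insert.prems(3), of e e'] that insert.hyps by auto
  have "subset_mean p I (\<lambda>S. \<Prod>e\<in>insert e F. f e (S \<inter> D e))
      = subset_mean p (D e \<union> (I - D e)) (\<lambda>S. \<Prod>e\<in>insert e F. f e (S \<inter> D e))"
    using De by (simp add: Un_absorb1)
  also have "\<dots> = subset_mean p (D e) (\<lambda>S. subset_mean p (I - D e)
      (\<lambda>S'. \<Prod>e\<in>insert e F. f e ((S \<union> S') \<inter> D e)))"
    using insert.prems fD p by (intro subset_mean_union) auto
  also have "\<dots> = subset_mean p (D e) (\<lambda>S. subset_mean p (I - D e)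
      (\<lambda>S'. f e S * (\<Prod>e\<in>F. f e (S' \<inter> D e))))"
  proof (intro subset_mean_cong fD)
    fix S S' assume S: "S \<subseteq> D e" "S' \<subseteq> I - D e"
    have "(S \<union> S') \<inter> D e = S" using S by auto
    moreover have "(\<Prod>e\<in>F. f e ((S \<union> S') \<inter> D e)) = (\<Prod>e\<in>F. f e (S' \<inter> D e))"
      by (intro prod.cong refl arg_cong[where f = "f _"]) (use S dis in blast)
    ultimately show "(\<Prod>e\<in>insert e F. f e ((S \<union> S') \<inter> D e)) = f e S * (\<Prod>e\<in>F. f e (S' \<inter> D e))"
      using insert.hyps by simp
  qed (use insert.prems in auto)
  also have "\<dots> = subset_mean p (D e) (\<lambda>S. (\<Prod>e\<in>F. subset_mean p (D e) (f e)) * f e S)"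
  proof -
    have "subset_mean p (I - D e) (\<lambda>S'. \<Prod>e\<in>F. f e (S' \<inter> D e)) = (\<Prod>e\<in>F. subset_mean p (D e) (f e))"
    proof (rule insert.IH)
      show "D e' \<subseteq> I - D e" if "e' \<in> F" for e' using insert.prems(2)[of e'] dis[OF that] that by auto
      show "disjoint_family_on D F"
        using insert.prems(3) by (rule disjoint_family_on_mono[rotated]) auto
    qed (use insert.prems in auto)
    then show ?thesis by (simp add: subset_mean_cmult mult.commute)
  qed
  finally show ?case using insert.hyps by (simp add: subset_mean_cmult)
qed simp

section \<open>Isolated edges of a random graph\<close>

text \<open>With \<open>U\<close> untouched and \<open>T\<close> touched, these are the unrevealed
  pairs that can still influence isolated edges inside \<open>U\<close>. For empty \<open>T\<close>
  they are all potential edges on \<open>U\<close>.\<close>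

definition incident_edges :: "'v set \<Rightarrow> 'v set \<Rightarrow> 'v set set" where
  "incident_edges U T = {e. e \<subseteq> U \<union> T \<and> card e = 2 \<and> e \<inter> U \<noteq> {}}"

definition isolated_edges :: "'v set \<Rightarrow> 'v set set \<Rightarrow> 'v set set" where
  "isolated_edges U S = {e \<in> S. e \<subseteq> U \<and> (\<forall>e'\<in>S. e' \<inter> e \<noteq> {} \<longrightarrow> e' = e)}"

definition star :: "'v \<Rightarrow> 'v set \<Rightarrow> 'v set set" where
  "star v N = (\<lambda>w. {v, w}) ` N"

lemma finite_incident_edges: "finite U \<Longrightarrow> finite T \<Longrightarrow> finite (incident_edges U T)"
  by (rule finite_subset[of _ "Pow (U \<union> T)"]) (auto simp: incident_edges_def)

lemma finite_isolated_edges: "finite S \<Longrightarrow> finite (isolated_edges U S)"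
  by (simp add: isolated_edges_def)

lemma inj_on_pair: "inj_on (\<lambda>w. {v, w}) (A - {v})"
  by (auto simp: inj_on_def doubleton_eq_iff)

lemma incident_edges_split:
  assumes "v \<in> U" "U \<inter> T = {}"
  shows "incident_edges U T = star v (U \<union> T - {v}) \<union> incident_edges (U - {v}) T"
    and "star v (U \<union> T - {v}) \<inter> incident_edges (U - {v}) T = {}"
proof -
  have "e \<in> star v (U \<union> T - {v}) \<union> incident_edges (U - {v}) T" if e: "e \<in> incident_edges U T" for e
  proof (cases "v \<in> e")
    case True
    then obtain w where "e = {v, w}" "w \<noteq> v"
      using e by (auto simp: incident_edges_def card_2_iff)
    then show ?thesis
      using e by (auto simp: incident_edges_def star_def)
  qed (use e in \<open>auto simp: incident_edges_def\<close>)
  then show "incident_edges U T = star v (U \<union> T - {v}) \<union> incident_edges (U - {v}) T"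
    using assms by (auto simp: incident_edges_def star_def card_insert_if)
  show "star v (U \<union> T - {v}) \<inter> incident_edges (U - {v}) T = {}"
    using assms by (auto simp: incident_edges_def star_def)
qed

text \<open>An edge of \<open>D \<union> S\<close> that meets \<open>U'\<close> cannot come from
  \<open>D\<close>, so it lies in \<open>S\<close> and ends in \<open>U' \<union> T'\<close>.
  Everything that could destroy isolation inside \<open>U'\<close> is thus already in
  \<open>incident_edges U' T'\<close>.\<close>

lemma isolated_edges_subset:
  assumes "U' \<subseteq> U" "\<Union>D \<inter> U' = {}" "\<And>e. e \<in> S \<Longrightarrow> e \<subseteq> U' \<union> T' \<and> card e = 2"
  shows "isolated_edges U' (S \<inter> incident_edges U' T') \<subseteq> isolated_edges U (D \<union> S)"
proof
  fix e assume e: "e \<in> isolated_edges U' (S \<inter> incident_edges U' T')"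
  have "e' = e" if e': "e' \<in> D \<union> S" "e' \<inter> e \<noteq> {}" for e'
  proof -
    have "e' \<inter> U' \<noteq> {}" using e e' by (auto simp: isolated_edges_def)
    then have "e' \<in> S \<inter> incident_edges U' T'"
      using e' assms(2) assms(3)[of e'] by (auto simp: incident_edges_def)
    then show ?thesis using e e' by (auto simp: isolated_edges_def)
  qed
  then show "e \<in> isolated_edges U (D \<union> S)"
    using e assms(1) by (auto simp: isolated_edges_def)
qed

text \<open>One step of the exploration: \<open>D\<close> holds the edges just revealed, whose end points leave the
  untouched set \<open>U\<close>, and \<open>F\<close> the isolated edges found among them. Edges inside the touched set \<open>T\<close>
  are never looked at, as they do not affect the isolated edges inside \<open>U\<close>.\<close>

lemma subset_mean_isolated_edges_le:
  assumes fin: "finite U" "finite T" and p: "0 \<le> p" "p \<le> 1" and c: "0 \<le> c" "c \<le> 1"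
    and U': "U' \<subseteq> U0" "U' \<subseteq> U" and cover: "U \<union> T = U' \<union> T'" 
    and D: "\<Union>D \<inter> U' = {}" "finite D"
    and F: "\<And>S. S \<subseteq> incident_edges U T \<Longrightarrow> F \<subseteq> isolated_edges U0 (D \<union> S)" "\<And>e. e \<in> F \<Longrightarrow> \<not> e \<subseteq> U'"
  shows "subset_mean p (incident_edges U T) (\<lambda>S. c ^ card (isolated_edges U0 (D \<union> S)))
    \<le> c ^ card F * subset_mean p (incident_edges U' T') (\<lambda>S. c ^ card (isolated_edges U' S))"
proof -
  have fin': "finite (incident_edges U T)" using fin by (rule finite_incident_edges)
  have sub: "incident_edges U' T' \<subseteq> incident_edges U T"
    using U' cover by (auto simp: incident_edges_def)
  have "c ^ card (isolated_edges U0 (D \<union> S))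
      \<le> c ^ card F * c ^ card (isolated_edges U' (S \<inter> incident_edges U' T'))"
    if S: "S \<subseteq> incident_edges U T" for S
  proof -
    let ?I = "isolated_edges U' (S \<inter> incident_edges U' T')"
    have finS: "finite S" using S fin' finite_subset by blast
    have "?I \<subseteq> isolated_edges U0 (D \<union> S)"
      by (rule isolated_edges_subset) (use U' D S cover in \<open>auto simp: incident_edges_def\<close>)
    then have "F \<union> ?I \<subseteq> isolated_edges U0 (D \<union> S)" using F(1)[OF S] by simp
    moreover have fI: "finite (isolated_edges U0 (D \<union> S))"
      using finS D(2) by (simp add: finite_isolated_edges)
    ultimately have "card (F \<union> ?I) \<le> card (isolated_edges U0 (D \<union> S))"
      by (intro card_mono)
    \<comment> \<open>Edges of \<open>F\<close> leave \<open>U'\<close> while those of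
      \<open>?I\<close> stay inside it, so nothing is counted twice.\<close>
    moreover have "card (F \<union> ?I) = card F + card ?I"
    proof (rule card_Un_disjoint)
      show "finite F" using F(1)[OF S] fI by (rule finite_subset)
      show "F \<inter> ?I = {}" using F(2) by (auto simp: isolated_edges_def)
    qed (use finS in \<open>simp add: finite_isolated_edges\<close>)
    ultimately show ?thesis
      using c by (simp add: power_decreasing flip: power_add)
  qed
  then have "subset_mean p (incident_edges U T) (\<lambda>S. c ^ card (isolated_edges U0 (D \<union> S)))
    \<le> subset_mean p (incident_edges U T)
        (\<lambda>S. c ^ card F * c ^ card (isolated_edges U' (S \<inter> incident_edges U' T')))"
    by (intro subset_mean_mono fin') 
  also have "\<dots> = c ^ card F * subset_mean p (incident_edges U' T') (\<lambda>S. c ^ card (isolated_edges U' S))"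
    using subset_mean_inter[OF fin' sub p, of "\<lambda>S. c ^ card (isolated_edges U' S)"]
    by (simp add: subset_mean_cmult)
  finally show ?thesis .
qed

lemma subset_mean_incident_edges:
  assumes fin: "finite U" "finite T" and p: "0 \<le> p" "p \<le> 1" and v: "v \<in> U" "U \<inter> T = {}"
  shows "subset_mean p (incident_edges U T) f = subset_mean p (U \<union> T - {v})
     (\<lambda>N. subset_mean p (incident_edges (U - {v}) T) (\<lambda>S. f (star v N \<union> S)))"
proof -
  have "subset_mean p (incident_edges U T) f = subset_mean p (star v (U \<union> T - {v}))
     (\<lambda>N. subset_mean p (incident_edges (U - {v}) T) (\<lambda>S. f (N \<union> S)))"
    unfolding incident_edges_split(1)[OF v]
    using fin by (intro subset_mean_union incident_edges_split(2) v p finite_incident_edges)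
      (auto simp: star_def)
  also have "\<dots> = subset_mean p (U \<union> T - {v})
     (\<lambda>N. subset_mean p (incident_edges (U - {v}) T) (\<lambda>S. f (star v N \<union> S)))"
    unfolding star_def using fin by (intro subset_mean_image inj_on_pair p) auto
  finally show ?thesis .
qed


section \<open>Induction along the exploration\<close>

text \<open>The hypothesis \<open>step\<close> says that the potential does not grow on average when
  a vertex is explored, with \<open>m\<close> other untouched vertices among \<open>M\<close> other
  vertices. Its first term is the mean growth if no isolated edge were ever found. The subtracted
  term is the saving when the vertex has exactly one neighbour and that one is untouched, an event
  of probability \<open>m * p * (1 - p) ^ (M - 1)\<close>.\<close>

lemma isolated_edges_mean_bound:
  fixes p c \<alpha> h :: real and n :: nat
  assumes p: "0 \<le> p" "p \<le> 1" and c: "0 \<le> c" "c \<le> 1" and \<alpha>: "0 \<le> \<alpha>" and h: "0 \<le> h"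
    and step: "\<And>m M :: nat. h < real m + 1 \<Longrightarrow> m \<le> M \<Longrightarrow> M < n \<Longrightarrow>
      exp \<alpha> * (1 + p * (exp \<alpha> - 1)) ^ M - real m * (p * (1 - p) ^ (M - 1) *
        ((exp \<alpha>)\<^sup>2 * (1 + (1 - c) * (1 - p) ^ (M - 1) - (1 + p * (exp \<alpha> - 1)) ^ (M - 1)))) \<le> 1"
    and fin: "finite U" "finite T" and disj: "U \<inter> T = {}" and n: "card (U \<union> T) \<le> n"
  shows "subset_mean p (incident_edges U T) (\<lambda>S. c ^ card (isolated_edges U S))
    \<le> exp (- \<alpha> * (real (card U) - h))"
  using fin disj n
proof (induction "card U" arbitrary: U T rule: less_induct)
  case (less U T)
  note fU = \<open>finite U\<close> and fT = \<open>finite T\<close> and UT = \<open>U \<inter> T = {}\<close> and cn = \<open>card (U \<union> T) \<le> n\<close>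
  define x where "x = exp \<alpha>"
  define K where "K = exp (- \<alpha> * (real (card U) - h))"
  define B where "B = 1 + p * (x - 1)"
  have x1: "1 \<le> x" using \<alpha> by (simp add: x_def)
  have K0: "0 < K" by (simp add: K_def)
  show ?case
  proof (cases "real (card U) \<le> h")
    \<comment> \<open>Below the threshold \<open>h\<close> the claimed bound is at least 1.\<close>
    case True
    have "subset_mean p (incident_edges U T) (\<lambda>S. c ^ card (isolated_edges U S))
        \<le> subset_mean p (incident_edges U T) (\<lambda>S. 1)"
      using c fU fT by (intro subset_mean_mono finite_incident_edges) (auto simp: power_le_one)
    also have "\<dots> \<le> exp (- \<alpha> * (real (card U) - h))"
      using True \<alpha> by (simp add: mult_nonneg_nonpos)
    finally show ?thesis .
  next
    case False
    with h have "U \<noteq> {}" by auto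
    then obtain v where v: "v \<in> U" by auto
    define R where "R = U \<union> T - {v}"
    define M where "M = card R"
    have fR: "finite R" using fU fT by (simp add: R_def)
    \<comment> \<open>The saving for a single untouched neighbour \<open>w\<close>. After exploring
      \<open>w\<close> the mean growth is \<open>x\<^sup>2 * B ^ (M - 1)\<close>, reduced by
      \<open>x\<^sup>2 * (1 - c)\<close> with probability \<open>(1 - p) ^ (M - 1)\<close>; the
      total is \<open>x\<^sup>2 - d\<close>.\<close>
    define d where "d = x\<^sup>2 * (1 + (1 - c) * (1 - p) ^ (M - 1) - B ^ (M - 1))"
    define inner where "inner N = subset_mean p (incident_edges (U - {v}) T)
        (\<lambda>S. c ^ card (isolated_edges U (star v N \<union> S)))" for N
    \<comment> \<open>Each lost untouched vertex costs a factor \<open>x\<close>; \<open>k\<close>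
      only has to bound the loss from above.\<close>
    have IH: "subset_mean p (incident_edges U' T') (\<lambda>S. c ^ card (isolated_edges U' S)) \<le> K * x ^ k"
      if U': "U' \<subset> U" "U' \<inter> T' = {}" "U' \<union> T' \<subseteq> U \<union> T" "card U \<le> card U' + k" for U' T' k
    proof -
      have fin': "finite U'" "finite T'" using U' fU fT by (auto intro: finite_subset)
      have "subset_mean p (incident_edges U' T') (\<lambda>S. c ^ card (isolated_edges U' S))
          \<le> exp (- \<alpha> * (real (card U') - h))"
      proof (rule less.hyps)
        show "card U' < card U" using U'(1) fU by (rule psubset_card_mono[rotated])
        show "card (U' \<union> T') \<le> n"
          using card_mono[OF _ U'(3)] fU fT cn by simp
      qed (use fin' U' in auto)
      also have "\<dots> \<le> exp (- \<alpha> * (real (card U) - h) + real k * \<alpha>)"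
      proof -
        have "\<alpha> * real (card U) \<le> \<alpha> * (real (card U') + real k)"
          using U'(4) \<alpha> by (intro mult_left_mono) auto
        then show ?thesis by (simp add: algebra_simps)
      qed
      also have "\<dots> = K * x ^ k" by (simp add: K_def x_def flip: exp_add exp_of_nat_mult)
      finally show ?thesis .
    qed
    \<comment> \<open>The neighbours of \<open>v\<close> become touched and no isolated edge is
      credited. At most \<open>card N + 1\<close> untouched vertices are lost, since some of
      \<open>N\<close> may be touched already.\<close>
    have any: "inner N \<le> K * (x * x ^ card N)" if N: "N \<subseteq> R" for N
    proof -
      have fN: "finite N" using N fR by (rule finite_subset)
      have "inner N \<le> c ^ card ({} :: 'a set set) * subset_mean p (incident_edges (U - {v} - N) (T \<union> N))
          (\<lambda>S. c ^ card (isolated_edges (U - {v} - N) S))"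
        unfolding inner_def
        by (rule subset_mean_isolated_edges_le)
          (use fU fT p c N fN in \<open>auto simp: R_def star_def\<close>)
      also have "\<dots> \<le> K * x ^ Suc (card N)"
      proof -
        have "card (U - {v}) - card N \<le> card (U - {v} - N)" by (rule diff_card_le_card_Diff) (rule fN)
        moreover have "card (U - {v}) = card U - 1" using v by simp
        ultimately have "card U \<le> card (U - {v} - N) + Suc (card N)" by linarith
        then have "subset_mean p (incident_edges (U - {v} - N) (T \<union> N))
            (\<lambda>S. c ^ card (isolated_edges (U - {v} - N) S)) \<le> K * x ^ Suc (card N)"
          using N v UT by (intro IH) (auto simp: R_def)
        then show ?thesis by simp
      qed
      finally show ?thesis by (simp add: mult_ac)
    qed
    \<comment> \<open>Here \<open>w\<close> is explored too, and \<open>N\<close> is the set of its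
      neighbours other than \<open>v\<close>. The edge \<open>{v, w}\<close> is isolated if
      \<open>N\<close> is empty, which earns the factor \<open>c\<close> through
      \<open>F\<close>.\<close>
    have single: "inner {w} \<le> K * (x\<^sup>2 - d)" if w: "w \<in> U - {v}" for w
    proof -
      have Rw: "U - {v} \<union> T - {w} = R - {w}" using v UT by (auto simp: R_def)
      have "inner {w} = subset_mean p (R - {w})
         (\<lambda>N. subset_mean p (incident_edges (U - {v} - {w}) T)
           (\<lambda>S. c ^ card (isolated_edges U (({{v, w}} \<union> star w N) \<union> S))))"
        unfolding inner_def Rw[symmetric]
        by (subst subset_mean_incident_edges[where v = w])
          (use fU fT p w UT in \<open>auto simp: star_def Un_assoc\<close>)
      also have "\<dots> \<le> subset_mean p (R - {w})
          (\<lambda>N. K * x\<^sup>2 * (x ^ card N - (1 - c) * of_bool (N = {})))"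
      proof (intro subset_mean_mono)
        fix N assume N: "N \<subseteq> R - {w}"
        have fN: "finite N" using N fR finite_subset by blast
        define F where "F = (if N = {} then {{v, w}} else {})"
        let ?U' = "U - {v} - {w} - N"
        have "subset_mean p (incident_edges (U - {v} - {w}) T)
           (\<lambda>S. c ^ card (isolated_edges U (({{v, w}} \<union> star w N) \<union> S)))
           \<le> c ^ card F * subset_mean p (incident_edges ?U' (T \<union> N))
              (\<lambda>S. c ^ card (isolated_edges ?U' S))"
        proof (rule subset_mean_isolated_edges_le)
          fix S assume S: "S \<subseteq> incident_edges (U - {v} - {w}) T"
          have "v \<notin> T" "w \<notin> T" using v w UT by auto
          then have "e' \<inter> {v, w} = {}" if "e' \<in> S" for e'
            using S that by (auto simp: incident_edges_def)
          then show "F \<subseteq> isolated_edges U ({{v, w}} \<union> star w N \<union> S)"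
            using v w by (auto simp: F_def isolated_edges_def star_def)
        qed (use fU fT p c N fN in \<open>auto simp: R_def star_def F_def split: if_splits\<close>)
        also have "\<dots> \<le> c ^ card F * (K * x ^ (card N + 2))"
        proof -
          have "card (U - {v} - {w}) - card N \<le> card ?U'" by (rule diff_card_le_card_Diff) (rule fN)
          moreover have "card (U - {v} - {w}) = card U - 2" using v w by simp
          ultimately have "card U \<le> card ?U' + (card N + 2)" by linarith
          then have "subset_mean p (incident_edges ?U' (T \<union> N))
              (\<lambda>S. c ^ card (isolated_edges ?U' S)) \<le> K * x ^ (card N + 2)"
            using N v UT by (intro IH) (auto simp: R_def)
          then show ?thesis using c by (intro mult_left_mono) auto
        qed
        also have "\<dots> = K * x\<^sup>2 * (x ^ card N - (1 - c) * of_bool (N = {}))"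
          by (simp add: F_def power_add power2_eq_square algebra_simps)
        finally show "subset_mean p (incident_edges (U - {v} - {w}) T)
           (\<lambda>S. c ^ card (isolated_edges U (({{v, w}} \<union> star w N) \<union> S)))
           \<le> K * x\<^sup>2 * (x ^ card N - (1 - c) * of_bool (N = {}))" .
      qed (use fR in auto)
      also have "\<dots> = K * x\<^sup>2 * (B ^ card (R - {w}) - (1 - c) * (1 - p) ^ card (R - {w}))"
        using fR p by (simp add: subset_mean_cmult subset_mean_diff subset_mean_power_card
            subset_mean_indicator B_def)
      also have "card (R - {w}) = M - 1"
        using w by (simp add: M_def R_def)
      also have "K * x\<^sup>2 * (B ^ (M - 1) - (1 - c) * (1 - p) ^ (M - 1)) = K * (x\<^sup>2 - d)"
        by (simp add: d_def algebra_simps)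
      finally show ?thesis .
    qed
    have "subset_mean p (incident_edges U T) (\<lambda>S. c ^ card (isolated_edges U S)) = subset_mean p R inner"
      unfolding inner_def R_def by (rule subset_mean_incident_edges) (use fU fT p v UT in auto)
    \<comment> \<open>At most one indicator is nonzero, so the sum applies the saving
      \<open>d\<close> exactly when \<open>N\<close> is a single untouched vertex.\<close>
    also have "\<dots> \<le> subset_mean p R
        (\<lambda>N. K * (x * x ^ card N - (\<Sum>w\<in>U - {v}. d * of_bool (N = {w}))))"
    proof (intro subset_mean_mono fR)
      fix N assume N: "N \<subseteq> R"
      show "inner N \<le> K * (x * x ^ card N - (\<Sum>w\<in>U - {v}. d * of_bool (N = {w})))"
      proof (cases "\<exists>u\<in>U - {v}. N = {u}")
        case True
        then obtain u where u: "u \<in> U - {v}" "N = {u}" by auto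
        have "(\<Sum>w\<in>U - {v}. d * of_bool (N = {w})) = (\<Sum>w\<in>U - {v}. if u = w then d else 0)"
          using u by (intro sum.cong) auto
        also have "\<dots> = d" using u fU by simp
        finally show ?thesis using single[OF u(1)] u by (simp add: power2_eq_square)
      next
        case False
        then have "(\<Sum>w\<in>U - {v}. d * of_bool (N = {w})) = 0" by (intro sum.neutral) auto
        then show ?thesis using any[OF N] by simp
      qed
    qed
    also have "\<dots> = K * (x * B ^ M - (\<Sum>w\<in>U - {v}. d * subset_mean p R (\<lambda>N. of_bool (N = {w}))))"
      using fR p by (simp add: subset_mean_cmult subset_mean_diff subset_mean_sum
          subset_mean_power_card B_def M_def)
    also have "(\<Sum>w\<in>U - {v}. d * subset_mean p R (\<lambda>N. of_bool (N = {w})))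
       = (\<Sum>w\<in>U - {v}. d * (p * (1 - p) ^ (M - 1)))"
    proof (intro sum.cong refl)
      fix w assume w: "w \<in> U - {v}"
      then have "w \<in> R" by (auto simp: R_def)
      then have "subset_mean p R (\<lambda>N. of_bool (N = {w})) = p * (1 - p) ^ (M - 1)"
        using subset_mean_indicator[OF fR, of "{w}" p] p fR by (simp add: M_def)
      then show "d * subset_mean p R (\<lambda>N. of_bool (N = {w})) = d * (p * (1 - p) ^ (M - 1))" by simp
    qed
    also have "K * (x * B ^ M - (\<Sum>w\<in>U - {v}. d * (p * (1 - p) ^ (M - 1))))
       = K * (x * B ^ M - real (card U - 1) * (p * (1 - p) ^ (M - 1) * d))"
      using v by simp
    also have "\<dots> \<le> K * 1"
    proof (intro mult_left_mono)
      have cU: "0 < card U" using v fU by (auto simp: card_gt_0_iff)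
      have "card (U - {v}) \<le> M"
        unfolding M_def by (rule card_mono) (use fR in \<open>auto simp: R_def\<close>)
      then have m: "card U - 1 \<le> M" using v by simp
      have "M = card (U \<union> T) - 1" using v by (simp add: M_def R_def)
      moreover have "0 < card (U \<union> T)" using v fU fT by (auto simp: card_gt_0_iff)
      ultimately have "M < n" using cn by linarith
      moreover have "h < real (card U - 1) + 1" using False cU by simp
      ultimately show "x * B ^ M - real (card U - 1) * (p * (1 - p) ^ (M - 1) * d) \<le> 1"
        using step[OF _ m] by (simp add: x_def B_def d_def)
    qed (use K0 in simp)
    finally show ?thesis by (simp add: K_def)
  qed
qed

section \<open>The decay rate\<close>

lemma exp_minus_one_le:
  fixes y :: real
  assumes "0 \<le> y" "y \<le> 1"
  shows "exp y \<le> 1 + 2 * y"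
proof -
  have "exp y \<le> 1 + y + y\<^sup>2" using assms by (rule exp_bound)
  moreover have "y\<^sup>2 \<le> y" using assms by (simp add: power2_eq_square mult_left_le)
  ultimately show ?thesis by linarith
qed

text \<open>The quadratic error in \<open>ln (1 - p) \<ge> - p - 2 * p\<^sup>2\<close> adds up to at
  most 1 over \<open>n\<close> factors, which is the extra \<open>- 1\<close> in the
  exponent.\<close>

lemma one_minus_power_ge:
  fixes p :: real
  assumes "0 \<le> p" "p \<le> 1/2" "2 * real n * p\<^sup>2 \<le> 1"
  shows "exp (- real n * p - 1) \<le> (1 - p) ^ n"
proof -
  have "- p - 2 * p\<^sup>2 \<le> ln (1 - p)" using assms by (intro ln_one_minus_pos_lower_bound)
  then have "real n * (- p - 2 * p\<^sup>2) \<le> real n * ln (1 - p)" by (intro mult_left_mono) auto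
  then have "exp (- real n * p - 1) \<le> exp (real n * ln (1 - p))"
    using assms by (simp add: algebra_simps)
  also have "\<dots> = (1 - p) ^ n" using assms by (simp add: exp_of_nat_mult)
  finally show ?thesis .
qed

text \<open>With mean degree \<open>g\<close>, an exploration step touches about \<open>1 + g\<close> vertices and finds an isolated
  edge with probability of order \<open>g e\<^sup>-\<^sup>2\<^sup>g\<close>; the rate is a small multiple of the quotient. The constant
  \<open>1/1200\<close> only has to be below \<open>e\<^sup>-\<^sup>2/128\<close>.\<close>

definition decay_rate :: "real \<Rightarrow> real" where
  "decay_rate g = g * exp (- 2 * g) / (1200 * (1 + 2 * g))"

text \<open>This is \<open>step\<close> for \<open>c = 7/8\<close>. The first term exceeds 1 by at
  most \<open>2 * \<alpha> * (1 + 2 * g)\<close>, that is \<open>g * E\<^sup>2 / 600\<close>. The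
  saving is at least \<open>g / 4 * L * (L / 16)\<close>, where \<open>L\<close> bounds
  \<open>(1 - p) ^ n\<close> from below.\<close>

lemma decay_rate_step:
  fixes p :: real and n m M :: nat
  defines "g \<equiv> real n * p" 
  defines "\<alpha> \<equiv> decay_rate g"
  assumes p: "0 \<le> p" "p \<le> 1/2" "2 * real n * p\<^sup>2 \<le> 1"
    and M: "M < n" and m: "real n \<le> 4 * real m"
  shows "exp \<alpha> * (1 + p * (exp \<alpha> - 1)) ^ M - real m * (p * (1 - p) ^ (M - 1) *
        ((exp \<alpha>)\<^sup>2 * (1 + (1 - 7/8) * (1 - p) ^ (M - 1) - (1 + p * (exp \<alpha> - 1)) ^ (M - 1)))) \<le> 1"
proof -
  define L where "L = exp (- g - 1)"
  define E where "E = exp (- g)"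
  define B where "B = 1 + p * (exp \<alpha> - 1)"
  define d where "d = 1 + (1 - 7/8) * (1 - p) ^ (M - 1) - B ^ (M - 1)"
  have g0: "0 \<le> g" using p by (simp add: g_def)
  have E0: "0 < E" "E \<le> 1" using g0 by (auto simp: E_def)
  have E2: "exp (- 2 * g) = E\<^sup>2" by (simp add: E_def power2_eq_square flip: exp_add)
  have L: "E \<le> 3 * L" "0 < L" "L \<le> 1"
  proof -
    have "E = exp 1 * L" by (simp add: E_def L_def flip: exp_add)
    then show "E \<le> 3 * L" using exp_le by (simp add: L_def)
  qed (use g0 in \<open>auto simp: L_def\<close>)
  \<comment> \<open>This keeps \<open>g * E\<^sup>2\<close> below \<open>E\<close>, so
    \<open>\<alpha>\<close> and \<open>g * \<alpha>\<close> are small compared with \<open>L\<close>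
    however large \<open>g\<close> is.\<close>
  have gE: "g * E \<le> 1"
  proof -
    have "g \<le> exp g" using exp_ge_add_one_self[of g] by linarith
    then have "g * E \<le> exp g * E" using E0 by (intro mult_right_mono) auto
    then show ?thesis by (simp add: E_def flip: exp_add)
  qed
  have a: "\<alpha> * (1 + 2 * g) = g * E\<^sup>2 / 1200"
  proof -
    have "\<alpha> = g * E\<^sup>2 / (1200 * (1 + 2 * g))" by (simp only: \<alpha>_def decay_rate_def E2)
    moreover have "y / (1200 * z) * z = y / 1200" if "z \<noteq> 0" for y z :: real
      using that by simp
    moreover have "1 + 2 * g \<noteq> 0" using g0 by linarith
    ultimately show ?thesis by metis
  qed
  have a0: "0 \<le> \<alpha>" using g0 by (simp add: \<alpha>_def decay_rate_def)
  have ga0: "0 \<le> g * \<alpha>" using g0 a0 by simp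
  have gEE: "g * E\<^sup>2 \<le> E" 
    using mult_right_mono[OF gE, of E] E0 by (simp add: power2_eq_square)
  have ag: "\<alpha> + 2 * (g * \<alpha>) = g * E\<^sup>2 / 1200" using a by (simp add: algebra_simps)
  have a1: "\<alpha> + 2 * (g * \<alpha>) \<le> 1" using ag gEE E0 by linarith
  have "exp \<alpha> \<le> 1 + 2 * \<alpha>" using a0 a1 ga0 by (intro exp_minus_one_le) auto
  then have delta: "p * (exp \<alpha> - 1) \<le> p * (2 * \<alpha>)" "0 \<le> p * (exp \<alpha> - 1)"
    using p a0 by (auto intro!: mult_left_mono)
  have B1: "1 \<le> B" using delta by (simp add: B_def)
  have Bn: "B ^ n \<le> exp (2 * (g * \<alpha>))"
  proof -
    have "B \<le> exp (p * (2 * \<alpha>))"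
      using delta exp_ge_add_one_self[of "p * (2 * \<alpha>)"] unfolding B_def by linarith
    then have "B ^ n \<le> exp (p * (2 * \<alpha>)) ^ n" using B1 by (intro power_mono) auto
    also have "\<dots> = exp (2 * (g * \<alpha>))" by (simp add: g_def mult_ac flip: exp_of_nat_mult)
    finally show ?thesis .
  qed
  have "B ^ M \<le> B ^ n" using M B1 by (intro power_increasing) auto
  then have "exp \<alpha> * B ^ M \<le> exp \<alpha> * exp (2 * (g * \<alpha>))" using Bn by (intro mult_left_mono) auto
  also have "\<dots> = exp (\<alpha> + 2 * (g * \<alpha>))" by (simp flip: exp_add)
  also have "\<dots> \<le> 1 + 2 * (\<alpha> + 2 * (g * \<alpha>))" using a0 ga0 a1 by (intro exp_minus_one_le) auto
  finally have first: "exp \<alpha> * B ^ M \<le> 1 + g * E\<^sup>2 / 600" unfolding ag by simp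
  have "B ^ (M - 1) \<le> B ^ n" using M B1 by (intro power_increasing) auto
  also have "\<dots> \<le> 1 + 2 * (2 * (g * \<alpha>))"
    using Bn exp_minus_one_le[of "2 * (g * \<alpha>)"] ga0 a0 a1 by linarith
  finally have BM: "B ^ (M - 1) \<le> 1 + L / 16" using ag gEE a0 L by linarith
  have "L \<le> (1 - p) ^ n" using one_minus_power_ge[OF p] by (simp add: L_def g_def)
  also have "\<dots> \<le> (1 - p) ^ (M - 1)" using M p by (intro power_decreasing) auto
  finally have Lp: "L \<le> (1 - p) ^ (M - 1)" .
  \<comment> \<open>The isolated edge contributes at least \<open>L / 8\<close>; the growth of
    \<open>B ^ (M - 1)\<close> uses up at most half of it.\<close>
  have d: "L / 16 \<le> d" using Lp BM by (simp add: d_def)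
  have "1 \<le> (exp \<alpha>)\<^sup>2" using a0 by simp
  then have xd: "L / 16 \<le> (exp \<alpha>)\<^sup>2 * d"
    using mult_right_mono[of 1 "(exp \<alpha>)\<^sup>2" d] d L by linarith
  have "g \<le> 4 * (real m * p)" using mult_right_mono[OF m p(1)] by (simp add: g_def)
  then have "g / 4 * (L * (L / 16)) \<le> (real m * p) * ((1 - p) ^ (M - 1) * ((exp \<alpha>)\<^sup>2 * d))"
    using Lp xd L g0 p by (intro mult_mono) auto
  \<comment> \<open>With \<open>E \<le> 3 * L\<close> this reduces to
    \<open>9 / 600 \<le> 1 / 64\<close>.\<close>
  moreover have "g * E\<^sup>2 / 600 \<le> g / 4 * (L * (L / 16))"
  proof -
    have "E * E \<le> (3 * L) * (3 * L)" using L E0 by (intro mult_mono) auto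
    then have "g * E\<^sup>2 \<le> g * (9 * (L * L))"
      using g0 by (intro mult_left_mono) (auto simp: power2_eq_square)
    moreover have "0 \<le> g * (L * L)" using g0 L by simp
    ultimately show ?thesis by (simp add: algebra_simps) 
  qed
  ultimately show ?thesis
    using first unfolding B_def[symmetric] d_def[symmetric] by (simp add: mult_ac)
qed

text \<open>For \<open>g < ln n / 2\<close> these bounds give \<open>2 * g\<^sup>2 \<le> n\<close>
  and \<open>g / n \<le> 1/2\<close>, as the dense regime requires.\<close>

lemma eventually_ln_bound: "\<forall>\<^sub>F n :: nat in sequentially. (ln (real n))\<^sup>2 \<le> 2 * real n \<and> ln (real n) \<le> real n"
  by (intro eventually_conj; real_asymp)

section \<open>Games on graphs with isolated edges\<close>

text \<open>The table entries that the players in \<open>A\<close> can consult; disjoint sets of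
  players own disjoint blocks.\<close>

definition best_response_block :: "'v graph \<Rightarrow> 'v set \<Rightarrow> ('v \<times> ('v \<Rightarrow> bool)) set" where
  "best_response_block G A = (SIGMA v : A. nbhd G v \<rightarrow>\<^sub>E UNIV)"

text \<open>Only the players in \<open>A\<close> have to be satisfied. The profile is a total
  function, as its values away from \<open>A\<close> and its neighbours do not matter.\<close>

definition local_PNE :: "'v graph \<Rightarrow> 'v set \<Rightarrow> ('v \<times> ('v \<Rightarrow> bool)) set \<Rightarrow> bool" where
  "local_PNE G A S \<longleftrightarrow>
     (\<exists>\<sigma>. \<forall>v\<in>A. BR_of_bits (\<lambda>x. x \<in> S) v (\<sigma> v) (restrict \<sigma> (nbhd G v)))"

lemma prob_game_pmf:
  assumes "simple_graph G"
  shows "measure_pmf.prob (game_pmf G) {BR. has_PNE G BR} =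
    subset_mean (1/2) (game_index G) (\<lambda>S. of_bool (has_PNE G (BR_of_bits (\<lambda>x. x \<in> S))))"
proof -
  have "game_pmf G = map_pmf (\<lambda>S. BR_of_bits (\<lambda>x. x \<in> S)) (random_subset (1/2) (game_index G))"
    unfolding game_pmf_def random_subset_def map_pmf_comp bernoulli_pmf_half_conv_pmf_of_set
    using finite_game_index[OF assms]
    by (intro map_pmf_cong refl arg_cong[where f = BR_of_bits])
       (auto simp: set_Pi_pmf PiE_dflt_def fun_eq_iff)
  then have "measure_pmf.prob (game_pmf G) {BR. has_PNE G BR} =
      measure_pmf.prob (random_subset (1/2) (game_index G)) {S. has_PNE G (BR_of_bits (\<lambda>x. x \<in> S))}"
    by (simp add: vimage_def)
  also have "\<dots> = subset_mean (1/2) (game_index G)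
      (indicator {S. has_PNE G (BR_of_bits (\<lambda>x. x \<in> S))})"
    by (simp add: subset_mean_def)
  also have "indicator {S. has_PNE G (BR_of_bits (\<lambda>x. x \<in> S))} =
      (\<lambda>S. of_bool (has_PNE G (BR_of_bits (\<lambda>x. x \<in> S))) :: real)"
    by (auto simp: indicator_def)
  finally show ?thesis .
qed

lemma has_PNE_imp_local_PNE:
  assumes "has_PNE G (BR_of_bits (\<lambda>x. x \<in> S))" "A \<subseteq> fst G"
  shows "local_PNE G A (S \<inter> best_response_block G A)"
proof -
  obtain \<sigma> where "\<And>v. v \<in> fst G \<Longrightarrow> BR_of_bits (\<lambda>x. x \<in> S) v (\<sigma> v) (restrict \<sigma> (nbhd G v))"
    using assms(1) by (auto simp: has_PNE_def is_PNE_def)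
  moreover have "(v, restrict \<sigma> (nbhd G v)) \<in> best_response_block G A" if "v \<in> A" for v
    using that by (simp add: best_response_block_def)
  ultimately have "\<forall>v\<in>A. BR_of_bits (\<lambda>x. x \<in> S \<inter> best_response_block G A) v (\<sigma> v) (restrict \<sigma> (nbhd G v))"
    using assms(2) by (simp add: BR_of_bits_def subset_iff)
  then show ?thesis unfolding local_PNE_def by blast
qed

text \<open>Two of the sixteen games on a single edge, the matching pennies games, have no equilibrium.\<close>

lemma subset_mean_local_PNE:
  assumes uw: "u \<noteq> w" and nb: "nbhd G u = {w}" "nbhd G w = {u}"
  shows "subset_mean (1/2) (best_response_block G {u, w}) (\<lambda>S. of_bool (local_PNE G {u, w} S)) = 7/8"
proof -
  \<comment> \<open>The table column in which the only neighbour \<open>x\<close> plays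
    \<open>t\<close>; each player of the edge has two of them.\<close>
  define \<tau> where "\<tau> x t = restrict (\<lambda>_. t) {x}" for x :: 'a and t :: bool
  have \<tau>: "\<tau> x t = \<tau> x t' \<longleftrightarrow> t = t'" for x t t'
    by (auto simp: \<tau>_def restrict_def fun_eq_iff)
  have restr: "restrict \<sigma> {x} = \<tau> x (\<sigma> x)" for \<sigma> x
    by (auto simp: \<tau>_def restrict_def fun_eq_iff)
  have PiE_range: "{x} \<rightarrow>\<^sub>E (UNIV :: bool set) = range (\<tau> x)" for x
  proof
    show "{x} \<rightarrow>\<^sub>E UNIV \<subseteq> range (\<tau> x)"
    proof
      fix f :: "'a \<Rightarrow> bool" assume "f \<in> {x} \<rightarrow>\<^sub>E UNIV"
      then have "f = \<tau> x (f x)" using restr[of f x] by (simp add: PiE_iff extensional_restrict)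
      then show "f \<in> range (\<tau> x)" by (rule range_eqI)
    qed
  qed (auto simp: \<tau>_def)
  have block: "best_response_block G {u, w} =
      {(u, \<tau> w True), (u, \<tau> w False), (w, \<tau> u True), (w, \<tau> u False)}"
  proof -
    have "best_response_block G {u, w} = {u} \<times> (nbhd G u \<rightarrow>\<^sub>E UNIV) \<union> {w} \<times> (nbhd G w \<rightarrow>\<^sub>E UNIV)"
      by (auto simp: best_response_block_def)
    also have "\<dots> = {u} \<times> range (\<tau> w) \<union> {w} \<times> range (\<tau> u)"
      unfolding nb PiE_range ..
    finally show ?thesis by (auto simp: UNIV_bool)
  qed
  have "local_PNE G {u, w} S \<longleftrightarrow>
      (\<exists>s t. ((u, \<tau> w t) \<in> S \<longleftrightarrow> \<not> s) \<and> ((w, \<tau> u s) \<in> S \<longleftrightarrow> \<not> t))" for S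
  proof
    assume "\<exists>s t. ((u, \<tau> w t) \<in> S \<longleftrightarrow> \<not> s) \<and> ((w, \<tau> u s) \<in> S \<longleftrightarrow> \<not> t)"
    then obtain s t where "(u, \<tau> w t) \<in> S \<longleftrightarrow> \<not> s" "(w, \<tau> u s) \<in> S \<longleftrightarrow> \<not> t" by auto
    then show "local_PNE G {u, w} S"
      unfolding local_PNE_def using nb uw
      by (intro exI[of _ "\<lambda>x. if x = u then s else t"]) (simp add: BR_of_bits_def restr)
  next
    assume "local_PNE G {u, w} S"
    then obtain \<sigma> where "BR_of_bits (\<lambda>x. x \<in> S) u (\<sigma> u) (\<tau> w (\<sigma> w))"
        "BR_of_bits (\<lambda>x. x \<in> S) w (\<sigma> w) (\<tau> u (\<sigma> u))"
      using nb by (auto simp: local_PNE_def restr)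
    then show "\<exists>s t. ((u, \<tau> w t) \<in> S \<longleftrightarrow> \<not> s) \<and> ((w, \<tau> u s) \<in> S \<longleftrightarrow> \<not> t)"
      by (intro exI[of _ "\<sigma> u"] exI[of _ "\<sigma> w"]) (simp add: BR_of_bits_def split: if_splits)
  qed
  then show ?thesis
    unfolding block using uw by (simp add: subset_mean_insert \<tau> ex_bool_eq)
qed

lemma isolated_edge_nbhd:
  assumes "simple_graph G" "e \<in> isolated_edges (fst G) (snd G)"
  obtains u w where "u \<noteq> w" "e = {u, w}" "nbhd G u = {w}" "nbhd G w = {u}"
proof -
  have e: "e \<in> snd G" "e \<subseteq> fst G" "\<And>e'. e' \<in> snd G \<Longrightarrow> e' \<inter> e \<noteq> {} \<Longrightarrow> e' = e"
    using assms(2) by (auto simp: isolated_edges_def)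
  have "card e = 2" using e(1) assms(1) by (simp add: simple_graph_def)
  then obtain u w where uw: "e = {u, w}" "u \<noteq> w" by (auto simp: card_2_iff)
  have "{x, y} \<in> snd G \<longleftrightarrow> {x, y} = e" if "x \<in> e" for x y
    using e(1) e(3)[of "{x, y}"] that by blast
  then have "nbhd G u = {w}" "nbhd G w = {u}"
    using uw e(2) by (auto simp: nbhd_def doubleton_eq_iff)
  then show ?thesis using that uw by blast
qed

text \<open>An equilibrium restricts to a local one on every isolated edge. Distinct isolated edges
  are disjoint, so these local events depend on disjoint blocks of bits and their probabilities
  multiply.\<close>

lemma prob_has_PNE_le:
  assumes G: "simple_graph G"
  shows "measure_pmf.prob (game_pmf G) {BR. has_PNE G BR}
    \<le> (7/8) ^ card (isolated_edges (fst G) (snd G))"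
proof -
  let ?F = "isolated_edges (fst G) (snd G)"
  let ?D = "best_response_block G"
  have "finite (fst G)" using G by (simp add: simple_graph_def)
  then have fin: "finite ?F"
    by (rule finite_subset[rotated, OF finite_Pow_iff[THEN iffD2]]) (auto simp: isolated_edges_def)
  have fI: "finite (game_index G)" using G by (rule finite_game_index)
  have "measure_pmf.prob (game_pmf G) {BR. has_PNE G BR} \<le>
      subset_mean (1/2) (game_index G) (\<lambda>S. \<Prod>e\<in>?F. of_bool (local_PNE G e (S \<inter> ?D e)))"
    unfolding prob_game_pmf[OF G]
  proof (intro subset_mean_mono fI)
    fix S
    show "of_bool (has_PNE G (BR_of_bits (\<lambda>x. x \<in> S)))
        \<le> (\<Prod>e\<in>?F. of_bool (local_PNE G e (S \<inter> ?D e)) :: real)"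
    proof (cases "has_PNE G (BR_of_bits (\<lambda>x. x \<in> S))")
      case True
      then have "local_PNE G e (S \<inter> ?D e)" if "e \<in> ?F" for e
        by (rule has_PNE_imp_local_PNE) (use that in \<open>auto simp: isolated_edges_def\<close>)
      then show ?thesis by simp
    qed (simp add: prod_nonneg)
  qed
  also have "\<dots> = (\<Prod>e\<in>?F. subset_mean (1/2) (?D e) (\<lambda>S. of_bool (local_PNE G e S)))"
  proof (rule subset_mean_prod[OF fin fI])
    show "?D e \<subseteq> game_index G" if "e \<in> ?F" for e
      using that by (auto simp: isolated_edges_def best_response_block_def game_index_def)
    show "disjoint_family_on ?D ?F"
      unfolding disjoint_family_on_def
    proof (intro ballI impI)
      fix e e' assume "e \<in> ?F" "e' \<in> ?F" "e \<noteq> e'"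
      then have "e \<inter> e' = {}" by (auto simp: isolated_edges_def)
      then show "?D e \<inter> ?D e' = {}" by (auto simp: best_response_block_def)
    qed
  qed auto
  also have "\<dots> = (\<Prod>e\<in>?F. 7/8)"
  proof (rule prod.cong[OF refl])
    fix e assume "e \<in> ?F"
    then obtain u w where "u \<noteq> w" "e = {u, w}" "nbhd G u = {w}" "nbhd G w = {u}"
      using isolated_edge_nbhd[OF G] by metis
    then show "subset_mean (1/2) (?D e) (\<lambda>S. of_bool (local_PNE G e S)) = 7/8"
      using subset_mean_local_PNE by metis
  qed
  finally show ?thesis by simp
qed

section \<open>From random games to isolated edges of the random graph\<close>

lemma prob_PNE_eq:
  "prob_PNE n p = subset_mean p (potential_edges n)
    (\<lambda>S. measure_pmf.prob (game_pmf ({..<n}, S)) {BR. has_PNE ({..<n}, S) BR})"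
proof -
  let ?M = "random_subset p (potential_edges n)"
  let ?N = "\<lambda>S. game_pmf ({..<n}, S)"
  have "random_game n p = bind_pmf ?M (\<lambda>S. map_pmf (\<lambda>BR. (({..<n}, S), BR)) (?N S))"
    by (simp add: random_game_def erdos_renyi_def random_subset_def bind_map_pmf)
  then have "ennreal (prob_PNE n p) = (\<integral>\<^sup>+S. emeasure (?N S) {BR. has_PNE ({..<n}, S) BR} \<partial>?M)"
    by (simp add: prob_PNE_def vimage_def flip: measure_pmf.emeasure_eq_measure)
  also have "\<dots> = (\<integral>\<^sup>+S. ennreal (measure_pmf.prob (?N S) {BR. has_PNE ({..<n}, S) BR}) \<partial>?M)"
    by (simp add: measure_pmf.emeasure_eq_measure)
  also have "\<dots> = ennreal (subset_mean p (potential_edges n)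
      (\<lambda>S. measure_pmf.prob (?N S) {BR. has_PNE ({..<n}, S) BR}))"
    unfolding subset_mean_def
    by (intro nn_integral_eq_integral integrable_measure_pmf_finite finite_set_random_subset
        finite_potential_edges) auto
  finally show ?thesis
    by (simp add: prob_PNE_def subset_mean_def)
qed

lemma prob_PNE_le_isolated_edges:
  "prob_PNE n p \<le> subset_mean p (incident_edges {..<n} {})
    (\<lambda>S. (7/8) ^ card (isolated_edges {..<n} S))"
proof -
  have "potential_edges n = incident_edges {..<n} {}"
    by (auto simp: potential_edges_def incident_edges_def Int_absorb2)
  moreover have "measure_pmf.prob (game_pmf ({..<n}, S)) {BR. has_PNE ({..<n}, S) BR}
      \<le> (7/8) ^ card (isolated_edges {..<n} S)" if "S \<subseteq> potential_edges n" for S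
    using prob_has_PNE_le[of "({..<n}, S)"] that by (auto simp: simple_graph_def potential_edges_def)
  ultimately show ?thesis
    unfolding prob_PNE_eq by (metis (no_types, lifting) finite_potential_edges subset_mean_mono)
qed

section \<open>Sparse and dense regimes\<close>

text \<open>The exploration starts with all \<open>n\<close> vertices untouched and is followed
  until \<open>n/2\<close> are left, so the exponent keeps half of
  \<open>decay_rate * n\<close>.\<close>

lemma prob_PNE_le:
  assumes n: "4 \<le> n" and p: "0 \<le> p" "p \<le> 1/2" "2 * real n * p\<^sup>2 \<le> 1"
  shows "prob_PNE n p \<le> exp (- (decay_rate (real n * p) * real n / 2))"
proof -
  have "prob_PNE n p \<le> subset_mean p (incident_edges {..<n} {})
      (\<lambda>S. (7/8) ^ card (isolated_edges {..<n} S))"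
    by (rule prob_PNE_le_isolated_edges)
  also have "\<dots> \<le> exp (- decay_rate (real n * p) * (real (card {..<n}) - real n / 2))"
  proof (rule isolated_edges_mean_bound[where n = n])
    fix m M :: nat
    assume "real n / 2 < real m + 1" "M < n"
    \<comment> \<open>From \<open>m > n/2 - 1\<close> and \<open>n \<ge> 4\<close>.\<close>
    moreover from this have "real n \<le> 4 * real m" using n by linarith
    ultimately show "exp (decay_rate (real n * p)) * (1 + p * (exp (decay_rate (real n * p)) - 1)) ^ M -
        real m * (p * (1 - p) ^ (M - 1) * ((exp (decay_rate (real n * p)))\<^sup>2 *
          (1 + (1 - 7/8) * (1 - p) ^ (M - 1) - (1 + p * (exp (decay_rate (real n * p)) - 1)) ^ (M - 1)))) \<le> 1"
      using p by (intro decay_rate_step)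
  qed (use p in \<open>auto simp: decay_rate_def\<close>)
  finally show ?thesis by (simp add: algebra_simps)
qed

text \<open>For \<open>g \<le> 1\<close> we have \<open>exp (- 2 * g) \<ge> 1/9\<close> and
  \<open>1 + 2 * g \<le> 3\<close>, so the rate is at least \<open>g / 32400\<close>; halving gives
  the constant, and \<open>g * n\<close> is \<open>n\<^sup>2 * p\<close>.\<close>

lemma prob_PNE_le_sparse:
  assumes n: "4 \<le> n" and p: "0 \<le> p" "p \<le> 1 / real n"
  shows "prob_PNE n p \<le> exp (- (1/64800) * (real n)\<^sup>2 * p)"
proof -
  define g where "g = real n * p"
  have g: "0 \<le> g" "g \<le> 1" using n p by (auto simp: g_def field_simps)
  have "1 / real n \<le> 1/4" using n by (intro divide_left_mono) auto
  then have p4: "p \<le> 1/4" using p by linarith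
  have "2 * real n * p\<^sup>2 = 2 * (g * p)" by (simp add: g_def power2_eq_square)
  also have "g * p \<le> 1 * (1/4)" using g p p4 by (intro mult_mono) auto
  finally have "prob_PNE n p \<le> exp (- (decay_rate g * real n / 2))"
    unfolding g_def using n p p4 by (intro prob_PNE_le) auto
  also have "\<dots> \<le> exp (- (1/64800) * (real n)\<^sup>2 * p)"
  proof -
    have "(exp 1)\<^sup>2 \<le> (3::real)\<^sup>2" using exp_le by (intro power_mono) auto
    then have "exp 2 \<le> (9::real)" by (simp flip: exp_of_nat_mult)
    then have "1/9 \<le> exp (- 2 :: real)" by (simp add: exp_minus field_simps)
    also have "\<dots> \<le> exp (- 2 * g)" using g by simp
    finally have "g * (1/9) / (1200 * 3) \<le> decay_rate g"
      unfolding decay_rate_def using g by (intro frac_le mult_left_mono) auto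
    then have "g * (1/9) / (1200 * 3) * real n / 2 \<le> decay_rate g * real n / 2"
      by (intro divide_right_mono mult_right_mono) auto
    then show ?thesis by (simp add: g_def power2_eq_square mult_ac)
  qed
  finally show ?thesis .
qed

text \<open>For \<open>g > 1\<close> the quotient \<open>g / (1 + 2 * g)\<close> is at least
  \<open>1/3\<close>, so the rate is at least \<open>exp (- 2 * g) / 3600\<close>. This would allow
  \<open>1/7200\<close>; the constant of the sparse regime is kept so that one \<kappa> serves
  both.\<close>

lemma prob_PNE_le_dense:
  assumes n: "4 \<le> n" "(ln (real n))\<^sup>2 \<le> 2 * real n" "ln (real n) \<le> real n"
    and g: "1 < g" "g < ln (real n) / 2"
  shows "prob_PNE n (g / real n) \<le> exp (- (1/64800) * exp (ln (real n) - 2 * g))"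
proof -
  have n0: "0 < real n" using n by simp
  have ng: "real n * (g / real n) = g" using n0 by simp
  have "g\<^sup>2 \<le> (ln (real n) / 2)\<^sup>2" using g by (intro power_mono) auto
  then have "2 * g\<^sup>2 \<le> real n" using n(2) by (simp add: power_divide)
  then have "2 * real n * (g / real n)\<^sup>2 \<le> 1"
    using n0 by (simp add: power_divide power2_eq_square field_simps)
  moreover have "g / real n \<le> 1/2" using g n n0 by (simp add: field_simps)
  ultimately have "prob_PNE n (g / real n) \<le> exp (- (decay_rate g * real n / 2))"
    using prob_PNE_le[of n "g / real n"] n(1) g ng by simp
  also have "\<dots> \<le> exp (- (1/64800) * exp (ln (real n) - 2 * g))"
  proof -
    have "exp (- 2 * g) * 1 \<le> exp (- 2 * g) * (3 * (g / (1 + 2 * g)))"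
      using g by (intro mult_left_mono) (auto simp: field_simps)
    also have "\<dots> = 3600 * decay_rate g" using g by (simp add: decay_rate_def field_simps)
    finally have "exp (- 2 * g) * real n \<le> 3600 * decay_rate g * real n"
      by (intro mult_right_mono) auto
    moreover have "exp (ln (real n) - 2 * g) = exp (- 2 * g) * real n"
      using n0 by (simp add: exp_diff exp_minus field_simps)
    moreover have "0 \<le> exp (- 2 * g) * real n" by simp
    ultimately show ?thesis unfolding exp_le_cancel_iff by linarith
  qed
  finally show ?thesis .
qed

section \<open>The limit statement and the final assembly\<close>

lemma prob_PNE_tendsto_0:
  fixes p \<epsilon> :: "nat \<Rightarrow> real" and \<kappa> :: real
  assumes \<kappa>: "0 < \<kappa>"
    and sparse: "\<And>n p. n \<ge> n0 \<Longrightarrow> 0 \<le> p \<Longrightarrow> p \<le> 1 \<Longrightarrow> p \<le> 1 / real n \<Longrightarrow>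
      prob_PNE n p \<le> exp (- \<kappa> * (real n)\<^sup>2 * p)"
    and dense: "\<And>n g. n \<ge> n0 \<Longrightarrow> 1 < g \<Longrightarrow> g < ln (real n) / 2 \<Longrightarrow>
      prob_PNE n (g / real n) \<le> exp (- \<kappa> * exp (ln (real n) - 2 * g))"
    and p: "\<forall>\<^sub>F n in sequentially. 0 \<le> p n \<and> p n \<le> 1"
    and np: "filterlim (\<lambda>n. (real n)\<^sup>2 * p n) at_top sequentially"
    and pe: "\<forall>\<^sub>F n in sequentially. p n < (1/2 - \<epsilon> n) * (ln (real n) / real n)"
    and \<epsilon>: "filterlim (\<lambda>n. \<epsilon> n * ln (real n)) at_top sequentially"
  shows "(\<lambda>n. prob_PNE n (p n)) \<longlonglongrightarrow> 0"
proof (rule tendsto_sandwich)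
  \<comment> \<open>The regime may change with \<open>n\<close>, so the majorant is the sum of the
    two bounds. In the second, \<open>ln n - 2 * g\<close> has been replaced by its lower bound
    \<open>2 * \<epsilon> n * ln n\<close>.\<close>
  let ?b = "\<lambda>n. exp (- (\<kappa> * ((real n)\<^sup>2 * p n))) + exp (- (\<kappa> * exp (2 * (\<epsilon> n * ln (real n)))))"
  show "\<forall>\<^sub>F n in sequentially. 0 \<le> prob_PNE n (p n)"
    by (simp add: prob_PNE_def)
  have "\<forall>\<^sub>F n in sequentially. 0 \<le> \<epsilon> n * ln (real n)"
    using \<epsilon> by (simp add: filterlim_at_top)
  with p pe eventually_ge_at_top[of "max n0 1"]
  show "\<forall>\<^sub>F n in sequentially. prob_PNE n (p n) \<le> ?b n"
  proof eventually_elim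
    case (elim n)
    have n: "n \<ge> n0" "0 < real n" using elim by auto
    define g where "g = real n * p n"
    have pg: "p n = g / real n" using n by (simp add: g_def)
    have "real n * p n < real n * ((1/2 - \<epsilon> n) * (ln (real n) / real n))"
      using elim n by (intro mult_strict_left_mono) auto
    then have g: "g < ln (real n) / 2 - \<epsilon> n * ln (real n)"
      using n by (simp add: g_def algebra_simps)
    show ?case
    proof (cases "g \<le> 1")
      case True
      then have "p n \<le> 1 / real n" using n by (simp add: pg divide_right_mono)
      then have "prob_PNE n (p n) \<le> exp (- \<kappa> * (real n)\<^sup>2 * p n)"
        using elim n by (intro sparse) auto
      also have "\<dots> = exp (- (\<kappa> * ((real n)\<^sup>2 * p n)))" by (simp add: mult_ac)
      also have "\<dots> \<le> ?b n" by simp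
      finally show ?thesis .
    next
      case False
      then have "prob_PNE n (p n) \<le> exp (- \<kappa> * exp (ln (real n) - 2 * g))"
        unfolding pg using elim n g by (intro dense) auto
      also have "\<dots> \<le> exp (- (\<kappa> * exp (2 * (\<epsilon> n * ln (real n)))))"
        using \<kappa> g by simp
      also have "\<dots> \<le> ?b n" by simp
      finally show ?thesis .
    qed
  qed
  have exp0: "((\<lambda>n. exp (- (\<kappa> * f n))) \<longlongrightarrow> 0) sequentially"
    if "filterlim f at_top sequentially" for f :: "nat \<Rightarrow> real"
    by (intro filterlim_compose[OF exp_at_bot] filterlim_compose[OF filterlim_uminus_at_bot_at_top]
        filterlim_tendsto_pos_mult_at_top[OF tendsto_const \<kappa> that])
  have "filterlim (\<lambda>n. exp (2 * (\<epsilon> n * ln (real n)))) at_top sequentially"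
    by (intro filterlim_compose[OF exp_at_top] filterlim_tendsto_pos_mult_at_top[OF tendsto_const _ \<epsilon>]) simp
  then have "?b \<longlonglongrightarrow> 0 + 0" by (intro tendsto_add exp0 np)
  then show "?b \<longlonglongrightarrow> 0" by simp
qed simp

theorem theorem1p10:
  "(\<exists>(\<kappa>::real) (n0::nat). \<kappa> > 0 \<and> (\<forall>n\<ge>n0.
      (\<forall>p::real. 0 \<le> p \<and> p \<le> 1 \<and> p \<le> 1 / real n \<longrightarrow>
         prob_PNE n p \<le> exp (- \<kappa> * (real n)\<^sup>2 * p)) \<and>
      (\<forall>(p::real) (g::real). p = g / real n \<and> 1 < g \<and> g < ln (real n) / 2 \<longrightarrow>
         prob_PNE n p \<le> exp (- \<kappa> * exp (ln (real n) - 2 * g)))))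
   \<and>
   (\<forall>(p::nat \<Rightarrow> real) (\<epsilon>::nat \<Rightarrow> real).
      (\<forall>\<^sub>F n in sequentially. 0 \<le> p n \<and> p n \<le> 1) \<and>
      filterlim (\<lambda>n. (real n)\<^sup>2 * p n) at_top sequentially \<and>
      (\<forall>\<^sub>F n in sequentially. p n < (1/2 - \<epsilon> n) * (ln (real n) / real n)) \<and>
      filterlim (\<lambda>n. \<epsilon> n * ln (real n)) at_top sequentially \<longrightarrow>
      (\<lambda>n. prob_PNE n (p n)) \<longlonglongrightarrow> 0)"
proof -
  obtain n1 where n1: "\<And>n. n \<ge> n1 \<Longrightarrow> (ln (real n))\<^sup>2 \<le> 2 * real n \<and> ln (real n) \<le> real n"
    using eventually_ln_bound by (auto simp: eventually_sequentially)
  \<comment> \<open>4 is what the exploration bound needs, \<open>n1\<close> what the logarithm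
    bounds of the dense regime need.\<close>
  define n0 where "n0 = max 4 n1"
  define \<kappa> :: real where "\<kappa> = 1/64800"
  have \<kappa>: "0 < \<kappa>" by (simp add: \<kappa>_def)
  have sparse: "prob_PNE n p \<le> exp (- \<kappa> * (real n)\<^sup>2 * p)"
    if "n \<ge> n0" "0 \<le> p" "p \<le> 1" "p \<le> 1 / real n" for n p
    using prob_PNE_le_sparse that by (simp add: \<kappa>_def n0_def)
  have dense: "prob_PNE n (g / real n) \<le> exp (- \<kappa> * exp (ln (real n) - 2 * g))"
    if "n \<ge> n0" "1 < g" "g < ln (real n) / 2" for n g
    using prob_PNE_le_dense n1 that by (simp add: \<kappa>_def n0_def)
  have tendsto: "(\<lambda>n. prob_PNE n (p n)) \<longlonglongrightarrow> 0"
    if "\<forall>\<^sub>F n in sequentially. 0 \<le> p n \<and> p n \<le> 1"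
      "filterlim (\<lambda>n. (real n)\<^sup>2 * p n) at_top sequentially"
      "\<forall>\<^sub>F n in sequentially. p n < (1/2 - \<epsilon> n) * (ln (real n) / real n)"
      "filterlim (\<lambda>n. \<epsilon> n * ln (real n)) at_top sequentially"
    for p \<epsilon> :: "nat \<Rightarrow> real"
    by (rule prob_PNE_tendsto_0[OF \<kappa> _ _ that]) (fact sparse, fact dense)
  show ?thesis
  proof (intro conjI exI[of _ \<kappa>] exI[of _ n0] allI impI \<kappa>; (elim conjE)?)
    fix n p assume "n0 \<le> n" "0 \<le> p" "p \<le> 1" "p \<le> 1 / real n"
    then show "prob_PNE n p \<le> exp (- \<kappa> * (real n)\<^sup>2 * p)" by (rule sparse)
  next
    fix n p g assume "n0 \<le> n" "p = g / real n" "1 < g" "g < ln (real n) / 2"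
    then show "prob_PNE n p \<le> exp (- \<kappa> * exp (ln (real n) - 2 * g))" using dense by simp
  next
    fix p \<epsilon> :: "nat \<Rightarrow> real"
    assume "\<forall>\<^sub>F n in sequentially. 0 \<le> p n \<and> p n \<le> 1"
      "filterlim (\<lambda>n. (real n)\<^sup>2 * p n) at_top sequentially"
      "\<forall>\<^sub>F n in sequentially. p n < (1/2 - \<epsilon> n) * (ln (real n) / real n)"
      "filterlim (\<lambda>n. \<epsilon> n * ln (real n)) at_top sequentially"
    then show "(\<lambda>n. prob_PNE n (p n)) \<longlonglongrightarrow> 0" by (rule tendsto)
  qed
qed

end
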